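(* Consider the action of $\mathrm{SL}(2,\mathbb{R})$ on $\mathrm{Sym}^+(2,\mathbb{R})^2$ given by $$(g,(\theta,\theta'))\mapsto (g^{-\top}\theta g^{-1},\,g^{-\top}\theta' g^{-1}),$$ and define $S:\mathrm{Sym}^+(2,\mathbb{R})^2\to(\mathbb{R}_{>0})^2\times\mathbb{R}$ by $$S(\theta,\theta')=\left(|\theta|,\,|\theta'|,\,\mathrm{tr}(\theta'\theta^{-1})\right).$$ Then $S$ is a maximal invariant of this group action.
   Context: $\mathrm{Sym}^+(2,\mathbb{R})$ is the set of real symmetric positive-definite $2\times2$ matrices; $|\theta|$ denotes the determinant of $\theta$, $\mathrm{tr}$ the trace, and $A^{-\top}=(A^{-1})^\top$. For a group $G$ acting on a set $X$, a map $\varphi:X\to Y$ is called a maximal invariant if $\varphi(gx)=\varphi(x)$ for all $g\in G$, $x\in X$, and whenever $\varphi(x_1)=\varphi(x_2)$ there exists $g\in G$ with $x_2=gx_1$. *)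

theory Defs
  imports "HOL-Analysis.Analysis" "HOL-Algebra.Group_Action"
begin

definition Sym_pos :: "(real^'n^'n) set"
  where "Sym_pos = {A. transpose A = A \<and> (\<forall>x. x \<noteq> 0 \<longrightarrow> 0 < x \<bullet> (A *v x))}"

definition SL :: "(real^'n^'n) monoid"
  where "SL = \<lparr>carrier = {g. det g = 1}, mult = (**), one = mat 1\<rparr>"

text \<open>The action is restricted to its domain because \<^const>\<open>BijGroup\<close> consists of
  extensional functions.\<close>

definition congr_action ::
  "real^'n^'n \<Rightarrow> (real^'n^'n) \<times> (real^'n^'n) \<Rightarrow> (real^'n^'n) \<times> (real^'n^'n)"
  where "congr_action g = (\<lambda>(\<theta>, \<theta>') \<in> Sym_pos \<times> Sym_pos.
    (transpose (matrix_inv g) ** \<theta> ** matrix_inv g,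
     transpose (matrix_inv g) ** \<theta>' ** matrix_inv g))"

definition S_map :: "(real^2^2) \<times> (real^2^2) \<Rightarrow> real \<times> real \<times> real"
  where "S_map = (\<lambda>(\<theta>, \<theta>'). (det \<theta>, det \<theta>', trace (\<theta>' ** matrix_inv \<theta>)))"

locale maximal_invariant = group_action G X \<alpha>
  for G (structure) and X and \<alpha> +
  fixes Y and f
  assumes maps_to: "f \<in> X \<rightarrow> Y"
    and invariant: "\<lbrakk>g \<in> carrier G; x \<in> X\<rbrakk> \<Longrightarrow> f (\<alpha> g x) = f x"
    and maximal: "\<lbrakk>x1 \<in> X; x2 \<in> X; f x1 = f x2\<rbrakk> \<Longrightarrow> \<exists>g\<in>carrier G. x2 = \<alpha> g x1"

end

theory Submission
  imports Defs
begin

text \<open>A pair of positive-definite forms is brought to a normal form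
  \<open>(\<surd>|\<theta>| I, diag(a, b))\<close> with \<open>b \<le> a\<close> by a congruence of determinant one: a triangular
  matrix turns the first form into a multiple of the identity, and a rotation diagonalises the
  second while fixing the first. By invariance, \<open>ab = |\<theta>'|\<close> and
  \<open>a + b = \<surd>|\<theta>| tr(\<theta>' \<theta>\<inverse>)\<close>, so the normal form depends only on \<open>S\<close>.\<close>

section \<open>Matrix congruence, inverses and the special linear group\<close>

text \<open>Parametrised by the matrix itself, so that \<open>congr_action g\<close> becomes
  \<open>congr (matrix_inv g)\<close> on both components and inverses stay out of the
  calculations.\<close>

definition congr :: "real^'n^'n \<Rightarrow> real^'n^'n \<Rightarrow> real^'n^'n"
  where "congr M A = transpose M ** A ** M"

lemma congr_congr: "congr N (congr M A) = congr (M ** N) A"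
  by (simp add: congr_def matrix_transpose_mul matrix_mul_assoc)

lemma congr_mat_1 [simp]: "congr (mat 1) A = A"
  by (simp add: congr_def)

lemma det_congr: "det (congr M A) = (det M)\<^sup>2 * det A"
  by (simp add: congr_def det_mul power2_eq_square)

lemma
  fixes A :: "real^'n^'n"
  assumes "invertible A"
  shows matrix_inv_right: "A ** matrix_inv A = mat 1"
    and matrix_inv_left: "matrix_inv A ** A = mat 1"
  using someI_ex [OF assms [unfolded invertible_def]] by (simp_all add: matrix_inv_def)

text \<open>A right inverse of a square matrix is already two-sided, so a single product identifies
  the inverse.\<close>

lemma matrix_inv_eq:
  fixes A B :: "real^'n^'n"
  assumes "A ** B = mat 1"
  shows "matrix_inv A = B"
proof -
  have "invertible A"
    using assms invertible_right_inverse by blast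
  then have "matrix_inv A ** (A ** B) = B"
    by (simp add: matrix_mul_assoc matrix_inv_left)
  with assms show ?thesis by simp
qed

lemma matrix_inv_SL:
  fixes g :: "real^'n^'n"
  assumes "det g = 1"
  shows "g ** matrix_inv g = mat 1" "matrix_inv g ** g = mat 1" "det (matrix_inv g) = 1"
proof -
  have "invertible g"
    using assms by (simp add: invertible_det_nz)
  then show 1: "g ** matrix_inv g = mat 1" and "matrix_inv g ** g = mat 1"
    by (simp_all add: matrix_inv_right matrix_inv_left)
  have "det g * det (matrix_inv g) = 1"
    using 1 by (metis det_I det_mul)
  with assms show "det (matrix_inv g) = 1" by simp
qed

lemma group_SL: "group (SL :: (real^'n^'n) monoid)"
proof (rule groupI)
  fix g :: "real^'n^'n"
  assume "g \<in> carrier SL"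
  then show "\<exists>h\<in>carrier SL. h \<otimes>\<^bsub>SL\<^esub> g = \<one>\<^bsub>SL\<^esub>"
    using matrix_inv_SL by (auto simp: SL_def)
qed (auto simp: SL_def det_mul matrix_mul_assoc)

section \<open>The congruence action on pairs of positive-definite matrices\<close>

text \<open>The quadratic form of \<open>congr M A\<close> at \<open>x\<close> is that of
  \<open>A\<close> at \<open>M *v x\<close>, which is nonzero because \<open>M\<close> is
  injective.\<close>

lemma congr_in_Sym_pos:
  fixes M :: "real^'n^'n"
  assumes M: "invertible M" and A: "A \<in> Sym_pos"
  shows "congr M A \<in> Sym_pos"
proof -
  have "0 < x \<bullet> (congr M A *v x)" if "x \<noteq> 0" for x
  proof -
    have "M *v x \<noteq> 0"
      using M that by (metis invertible_left_inverse matrix_left_invertible_ker)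
    then have "0 < (M *v x) \<bullet> (A *v (M *v x))"
      using A by (simp add: Sym_pos_def)
    also have "\<dots> = (x v* transpose M) \<bullet> (A *v (M *v x))"
      by simp
    also have "\<dots> = x \<bullet> (congr M A *v x)"
      by (simp only: congr_def dot_lmul_matrix matrix_vector_mul_assoc matrix_mul_assoc)
    finally show ?thesis .
  qed
  moreover have "transpose (congr M A) = congr M A"
    using A by (simp add: Sym_pos_def congr_def matrix_transpose_mul matrix_mul_assoc)
  ultimately show ?thesis by (simp add: Sym_pos_def)
qed

text \<open>A nonzero kernel vector would make the quadratic form vanish, so the kernel is
  trivial.\<close>

lemma invertible_Sym_pos:
  assumes "A \<in> Sym_pos"
  shows "invertible A"
proof -
  have "x = 0" if "A *v x = 0" for x
    using assms that by (force simp: Sym_pos_def)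
  then show ?thesis
    by (metis invertible_left_inverse matrix_left_invertible_ker)
qed

lemma congr_action_eq:
  assumes "\<theta> \<in> Sym_pos" "\<theta>' \<in> Sym_pos"
  shows "congr_action g (\<theta>, \<theta>') = (congr (matrix_inv g) \<theta>, congr (matrix_inv g) \<theta>')"
  using assms by (simp add: congr_action_def congr_def)

lemma congr_action_in:
  fixes g :: "real^'n^'n"
  assumes g: "det g = 1" and x: "x \<in> Sym_pos \<times> Sym_pos"
  shows "congr_action g x \<in> Sym_pos \<times> Sym_pos"
proof -
  have "invertible (matrix_inv g)"
    using g by (simp add: invertible_det_nz matrix_inv_SL)
  then show ?thesis
    using x by (auto simp: congr_action_eq congr_in_Sym_pos)
qed

text \<open>Congruence composes in reverse order, and so does inversion; the two reversals cancel,
  which gives a left action.\<close>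

lemma congr_action_mult:
  fixes g h :: "real^'n^'n"
  assumes g: "det g = 1" and h: "det h = 1" and x: "x \<in> Sym_pos \<times> Sym_pos"
  shows "congr_action (g ** h) x = congr_action g (congr_action h x)"
proof -
  obtain \<theta> \<theta>' where x_eq: "x = (\<theta>, \<theta>')" and \<theta>: "\<theta> \<in> Sym_pos" "\<theta>' \<in> Sym_pos"
    using x by auto
  have "(g ** h) ** (matrix_inv h ** matrix_inv g) = g ** (h ** matrix_inv h) ** matrix_inv g"
    by (simp only: matrix_mul_assoc)
  then have inv: "matrix_inv (g ** h) = matrix_inv h ** matrix_inv g"
    by (intro matrix_inv_eq) (simp add: g h matrix_inv_SL)
  have "congr (matrix_inv h) \<theta> \<in> Sym_pos" "congr (matrix_inv h) \<theta>' \<in> Sym_pos"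
    using congr_action_in [OF h x] \<theta> by (auto simp: x_eq congr_action_eq)
  then show ?thesis
    by (simp add: x_eq \<theta> congr_action_eq congr_congr inv)
qed

lemma congr_action_1:
  fixes x :: "(real^'n^'n) \<times> (real^'n^'n)"
  assumes "x \<in> Sym_pos \<times> Sym_pos"
  shows "congr_action (mat 1) x = x"
proof -
  have "matrix_inv (mat 1 :: real^'n^'n) = mat 1"
    by (simp add: matrix_inv_eq)
  with assms show ?thesis by (auto simp: congr_action_eq)
qed

text \<open>The inverse matrix supplies the inverse map, hence bijectivity. Since all maps involved
  are extensional, the homomorphism law need only be checked on the domain.\<close>

lemma group_action_congr_action:
  "group_action (SL :: (real^'n^'n) monoid) (Sym_pos \<times> Sym_pos) congr_action"
proof -
  let ?X = "Sym_pos \<times> Sym_pos :: ((real^'n^'n) \<times> (real^'n^'n)) set"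
  have cancel: "congr_action h (congr_action g x) = x"
    if "h ** g = mat 1" "det g = 1" "det h = 1" "x \<in> ?X" for g h :: "real^'n^'n" and x
    using that by (metis congr_action_1 congr_action_mult)
  have Bij: "congr_action g \<in> Bij ?X" if g: "det g = 1" for g :: "real^'n^'n"
  proof -
    let ?h = "matrix_inv g"
    have "bij_betw (congr_action g) ?X ?X"
    proof (rule bij_betw_byWitness [where f' = "congr_action ?h"])
      show "\<forall>x\<in>?X. congr_action ?h (congr_action g x) = x"
        "\<forall>x\<in>?X. congr_action g (congr_action ?h x) = x"
        using cancel g matrix_inv_SL [OF g] by blast+
      show "congr_action g ` ?X \<subseteq> ?X" "congr_action ?h ` ?X \<subseteq> ?X"
        using congr_action_in g matrix_inv_SL(3) [OF g] by blast+
    qed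
    moreover have "congr_action g \<in> extensional ?X"
      by (simp add: congr_action_def)
    ultimately show ?thesis by (simp add: Bij_def)
  qed
  have "congr_action (g ** h) = compose ?X (congr_action g) (congr_action h)"
    if "det g = 1" "det h = 1" for g h :: "real^'n^'n"
  proof (rule extensionalityI [of _ ?X])
    show "congr_action (g ** h) \<in> extensional ?X"
      by (simp add: congr_action_def)
    show "congr_action (g ** h) x = compose ?X (congr_action g) (congr_action h) x"
      if "x \<in> ?X" for x
      using \<open>det g = 1\<close> \<open>det h = 1\<close> that by (simp only: compose_eq congr_action_mult)
  qed simp
  then have "congr_action \<in> hom (SL :: (real^'n^'n) monoid) (BijGroup ?X)"
    by (auto simp: hom_def SL_def BijGroup_def Bij)
  then show ?thesis
    by (simp add: group_action_def group_hom_def group_hom_axioms_def group_SL group_BijGroup)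
qed

section \<open>Invariance of \<open>S_map\<close>\<close>

text \<open>Determinants are multiplied by the square of \<open>det M\<close>, which is 1. The
  product of \<theta>' with the inverse of \<theta> is conjugated by \<open>transpose M\<close>, and
  the trace is unchanged by conjugation.\<close>

lemma S_map_congr:
  fixes M :: "real^2^2"
  assumes M: "det M = 1" and \<theta>: "\<theta> \<in> Sym_pos"
  shows "S_map (congr M \<theta>, congr M \<theta>') = S_map (\<theta>, \<theta>')"
proof -
  let ?N = "matrix_inv M"
  have inv_T: "transpose M ** transpose ?N = mat 1"
    by (simp add: M matrix_inv_SL flip: matrix_transpose_mul)
  have inv_\<theta>: "\<theta> ** matrix_inv \<theta> = mat 1"
    by (simp add: \<theta> invertible_Sym_pos matrix_inv_right)
  have "congr M \<theta> ** (?N ** matrix_inv \<theta> ** transpose ?N)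
      = transpose M ** (\<theta> ** (M ** ?N) ** matrix_inv \<theta>) ** transpose ?N"
    by (simp only: congr_def matrix_mul_assoc)
  then have "matrix_inv (congr M \<theta>) = ?N ** matrix_inv \<theta> ** transpose ?N"
    by (intro matrix_inv_eq) (simp add: M matrix_inv_SL inv_\<theta> inv_T)
  then have "congr M \<theta>' ** matrix_inv (congr M \<theta>)
      = transpose M ** (\<theta>' ** (M ** ?N) ** matrix_inv \<theta> ** transpose ?N)"
    by (simp only: congr_def matrix_mul_assoc)
  also have "\<dots> = transpose M ** (\<theta>' ** matrix_inv \<theta> ** transpose ?N)"
    by (simp add: M matrix_inv_SL)
  finally have "trace (congr M \<theta>' ** matrix_inv (congr M \<theta>))
      = trace ((\<theta>' ** matrix_inv \<theta> ** transpose ?N) ** transpose M)"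
    by (metis trace_mul_sym)
  also have "(\<theta>' ** matrix_inv \<theta> ** transpose ?N) ** transpose M
      = \<theta>' ** matrix_inv \<theta> ** transpose (M ** ?N)"
    by (simp only: matrix_transpose_mul matrix_mul_assoc)
  also have "\<dots> = \<theta>' ** matrix_inv \<theta>"
    by (simp add: M matrix_inv_SL)
  finally show ?thesis
    by (simp add: S_map_def det_congr M)
qed

section \<open>Two-by-two matrices by entries\<close>

text \<open>Entries are listed row by row; with them as arguments, matrix identities reduce to
  polynomial identities in real numbers.\<close>

definition mat2 :: "real \<Rightarrow> real \<Rightarrow> real \<Rightarrow> real \<Rightarrow> real^2^2"
  where "mat2 a b c d = vector [vector [a, b], vector [c, d]]"

lemma mat2_cases:
  obtains a b c d where "A = mat2 a b c d"
proof
  show "A = mat2 (A$1$1) (A$1$2) (A$2$1) (A$2$2)"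
    by (simp add: mat2_def vec_eq_iff forall_2)
qed

lemma mat2_simps [simp]:
  "mat2 a b c d = mat2 a' b' c' d' \<longleftrightarrow> a = a' \<and> b = b' \<and> c = c' \<and> d = d'"
  "transpose (mat2 a b c d) = mat2 a c b d"
  "mat2 a b c d ** mat2 a' b' c' d'
    = mat2 (a * a' + b * c') (a * b' + b * d') (c * a' + d * c') (c * b' + d * d')"
  "det (mat2 a b c d) = a * d - b * c"
  "trace (mat2 a b c d) = a + d"
  by (auto simp: mat2_def vec_eq_iff forall_2 transpose_def matrix_matrix_mult_def det_2
      sum_2 trace_def)

lemma mat_1_mat2: "mat 1 = mat2 1 0 0 1"
  by (simp add: mat2_def vec_eq_iff forall_2 mat_def)

lemma mat2_Sym_pos:
  assumes "mat2 p q q' r \<in> Sym_pos"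
  shows "q' = q" "0 < p" "0 < p * r - q * q"
proof -
  have "transpose (mat2 p q q' r) = mat2 p q q' r"
    using assms unfolding Sym_pos_def by blast
  then show q: "q' = q"
    unfolding mat2_simps by blast
  have pos: "0 < p * x * x + 2 * q * x * y + r * y * y" if "x \<noteq> 0 \<or> y \<noteq> 0" for x y
  proof -
    have "(vector [x, y] :: real^2) \<noteq> 0"
      using that by (auto simp: vec_eq_iff forall_2)
    then have "0 < vector [x, y] \<bullet> (mat2 p q q' r *v vector [x, y])"
      using assms unfolding Sym_pos_def by blast
    then show ?thesis
      by (simp add: q mat2_def inner_vec_def sum_2 matrix_vector_mult_def algebra_simps)
  qed
  show p: "0 < p"
    using pos [of 1 0] by simp
  \<comment> \<open>The vector \<open>(-q, p)\<close> is orthogonal to the first row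
    \<open>(p, q)\<close>, so the form takes there the value \<open>p\<close> times the
    determinant.\<close>
  have "0 < p * (p * r - q * q)"
    using pos [of "-q" p] p by (simp add: algebra_simps)
  with p show "0 < p * r - q * q"
    by (simp add: zero_less_mult_iff)
qed

lemma Sym_pos_cases:
  assumes "A \<in> Sym_pos"
  obtains p q r where "A = mat2 p q q r" "0 < p" "0 < det A"
proof -
  obtain p q q' r where A: "A = mat2 p q q' r"
    by (rule mat2_cases)
  note pos = mat2_Sym_pos [OF assms [unfolded A]]
  show ?thesis
    by (rule that [of p q r]) (use pos(2,3) in \<open>simp_all add: A pos(1)\<close>)
qed

lemma det_Sym_pos:
  fixes A :: "real^2^2"
  assumes "A \<in> Sym_pos"
  shows "0 < det A"
  using assms by (rule Sym_pos_cases)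

section \<open>Simultaneous normal form of two matrices\<close>

text \<open>Completing the square: a shear removes the mixed term and leaves the diagonal entries
  \<open>p\<close> and \<open>det A / p\<close>; a diagonal matrix of determinant one then makes
  these equal.\<close>

lemma normalise_Sym_pos:
  assumes "A \<in> Sym_pos"
  obtains M where "det M = 1"
    and "congr M A = mat2 (sqrt (det A)) 0 0 (sqrt (det A))"
proof -
  obtain p q r where A: "A = mat2 p q q r" and p: "0 < p" and d: "0 < det A"
    using assms by (rule Sym_pos_cases)
  define e where "e = sqrt (det A)"
  have e: "0 < e" "e * e = p * r - q * q"
    using d by (auto simp: e_def A)
  \<comment> \<open>Scaling by \<open>s\<close> and \<open>1 / s\<close> turns the diagonal entries
    into \<open>p * s * s\<close> and \<open>det A / (p * s * s)\<close>; this choice makes both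
    equal to \<open>e\<close>. The matrix \<open>?M\<close> below is the shear with upper right
    entry \<open>- q / p\<close> followed on the right by this scaling.\<close>
  define s where "s = sqrt (e / p)"
  have s: "0 < s" "s * s = e / p"
    using e p by (auto simp: s_def)
  let ?M = "mat2 s (- q / (p * s)) 0 (1 / s)"
  have "det ?M = 1"
    using s by simp
  moreover have "congr ?M A = mat2 e 0 0 e"
  proof -
    have 1: "s * p * s = e"
      using s p by (simp add: field_simps)
    have "(p * r - q * q) / (p * (s * s)) = e"
      using s e p by (simp flip: e(2))
    then have "r / (s * s) - q * q / (p * (s * s)) = e"
      using s(1) p by (simp add: diff_divide_distrib)
    then show ?thesis
      using s(1) p 1 by (simp add: A congr_def field_simps)
  qed
  ultimately show ?thesis
    using that unfolding e_def by blast
qed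

text \<open>The trace-free part of the matrix corresponds to the complex number \<open>u\<close>,
  and congruence by the rotation through \<open>t\<close> multiplies \<open>u\<close> by
  \<open>cis (- 2 * t)\<close>. Half the argument of \<open>u\<close> therefore makes it real and
  nonnegative, which kills the off-diagonal entry and orders the diagonal.\<close>

lemma rotate_to_diagonal:
  obtains R a b where "det R = 1" "transpose R ** R = mat 1" "b \<le> a"
    and "congr R (mat2 x y y z) = mat2 a 0 0 b"
proof -
  define u where "u = Complex ((x - z) / 2) y"
  define h where "h = cmod u"
  \<comment> \<open>The case \<open>u = 0\<close> needs no separate treatment: then
    \<open>h = 0\<close>, and every angle works.\<close>
  define t where "t = Arg u / 2"
  define c where "c = cos t"
  define s where "s = sin t"
  have cs: "c * c + s * s = 1"
    by (simp add: c_def s_def flip: power2_eq_square)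
  have "u = h * cis (2 * t)"
    using rcis_cmod_Arg [of u] by (simp add: h_def t_def rcis_def)
  then have "(x - z) / 2 = h * cos (2 * t)" and y: "y = h * sin (2 * t)"
    by (auto simp: complex_eq_iff u_def)
  then have xz: "x = z + 2 * h * (c * c - s * s)" and y: "y = 2 * h * c * s"
    by (auto simp: cos_double sin_double power2_eq_square c_def s_def)
  \<comment> \<open>Here \<open>a\<close> and \<open>b\<close> are the eigenvalues
    \<open>(x + z) / 2 + h\<close> and \<open>(x + z) / 2 - h\<close>, rewritten by means of
    \<open>xz\<close> and \<open>cs\<close>.\<close>
  define a where "a = z + 2 * h * c * c"
  define b where "b = z - 2 * h * s * s"
  let ?R = "mat2 c (-s) s c"
  have "congr ?R (mat2 x y y z) = mat2 a 0 0 b"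
    using cs xz y unfolding a_def b_def congr_def by simp algebra
  moreover have "b \<le> a"
  proof -
    have "a - b = 2 * h * (c * c + s * s)"
      by (simp add: a_def b_def algebra_simps)
    also have "\<dots> \<ge> 0"
      by (simp add: cs h_def)
    finally show ?thesis by simp
  qed
  moreover have "det ?R = 1" "transpose ?R ** ?R = mat 1"
    using cs by (simp_all add: mat_1_mat2 algebra_simps)
  ultimately show ?thesis
    using that by blast
qed

text \<open>By the equal sums and products, \<open>a\<close> is a root of the quadratic with roots
  \<open>a'\<close> and \<open>b'\<close>. If \<open>a = b'\<close>, then \<open>b = a'\<close>, and
  the two orderings force all four numbers to coincide.\<close>

lemma sum_prod_ordered_unique:
  fixes a b a' b' :: real
  assumes "a + b = a' + b'" "a * b = a' * b'" "b \<le> a" "b' \<le> a'"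
  shows "a = a' \<and> b = b'"
proof -
  have "(a - a') * (a - b') = a * a - a * (a' + b') + a' * b'"
    by (simp add: algebra_simps)
  also have "\<dots> = 0"
    by (simp add: algebra_simps flip: assms(1,2))
  finally show ?thesis
    using assms by auto
qed

lemma normal_form:
  assumes \<theta>: "\<theta> \<in> Sym_pos" and \<theta>': "\<theta>' \<in> Sym_pos"
  obtains M a b where "det M = 1" "b \<le> a" "a * b = det \<theta>'"
    and "a + b = sqrt (det \<theta>) * trace (\<theta>' ** matrix_inv \<theta>)"
    and "congr M \<theta> = mat2 (sqrt (det \<theta>)) 0 0 (sqrt (det \<theta>))"
    and "congr M \<theta>' = mat2 a 0 0 b"
proof -
  define e where "e = sqrt (det \<theta>)"
  have e: "0 < e"
    using \<theta> det_Sym_pos by (simp add: e_def)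
  obtain N where N: "det N = 1" "congr N \<theta> = mat2 e 0 0 e"
    using normalise_Sym_pos [OF \<theta>] by (auto simp: e_def)
  have "congr N \<theta>' \<in> Sym_pos"
    using N \<theta>' by (simp add: congr_in_Sym_pos invertible_det_nz)
  then obtain x y z where xyz: "congr N \<theta>' = mat2 x y y z"
    by (rule Sym_pos_cases)
  obtain R a b where R: "det R = 1" "transpose R ** R = mat 1" "b \<le> a"
    and diag: "congr R (mat2 x y y z) = mat2 a 0 0 b"
    by (rule rotate_to_diagonal)
  \<comment> \<open>A scalar matrix commutes with \<open>R\<close>, so the orthogonality of
    \<open>R\<close> leaves it fixed.\<close>
  have "mat2 e 0 0 e = e *\<^sub>R mat 1"
    by (simp add: mat2_def vec_eq_iff forall_2 mat_def)
  then have "congr R (mat2 e 0 0 e) = mat2 e 0 0 e"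
    using R by (simp add: congr_def matrix_scalar_ac flip: scalar_matrix_assoc)
  then have \<theta>_eq: "congr (N ** R) \<theta> = mat2 e 0 0 e"
    and \<theta>'_eq: "congr (N ** R) \<theta>' = mat2 a 0 0 b"
    using N xyz diag by (simp_all flip: congr_congr)
  have det: "det (N ** R) = 1"
    using N R by (simp add: det_mul)
  have "matrix_inv (mat2 e 0 0 e) = mat2 (1 / e) 0 0 (1 / e)"
    using e by (intro matrix_inv_eq) (simp add: mat_1_mat2)
  \<comment> \<open>Invariance of \<open>S_map\<close> under \<open>N ** R\<close> allows the
    determinant and the trace to be computed on the diagonal matrices.\<close>
  then have "a * b = det \<theta>'" "(a + b) / e = trace (\<theta>' ** matrix_inv \<theta>)"
    using S_map_congr [OF det \<theta>, of \<theta>'] \<theta>_eq \<theta>'_eq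
    by (simp_all add: S_map_def add_divide_distrib)
  then show ?thesis
    using that [OF det R(3)] \<theta>_eq \<theta>'_eq e by (auto simp: e_def field_simps)
qed

section \<open>Equal invariants yield a common orbit\<close>

theorem proposition2:
  shows "maximal_invariant (SL :: (real^2^2) monoid) (Sym_pos \<times> Sym_pos) congr_action
           ({0<..} \<times> {0<..} \<times> UNIV) S_map"
proof (intro maximal_invariant.intro maximal_invariant_axioms.intro group_action_congr_action)
  show "S_map \<in> Sym_pos \<times> Sym_pos \<rightarrow> {0<..} \<times> {0<..} \<times> UNIV"
    by (auto simp: S_map_def det_Sym_pos)
next
  fix g :: "real^2^2" and x :: "(real^2^2) \<times> (real^2^2)"
  assume "g \<in> carrier SL" "x \<in> Sym_pos \<times> Sym_pos"
  then show "S_map (congr_action g x) = S_map x"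
    by (auto simp: SL_def congr_action_eq S_map_congr matrix_inv_SL)
next
  fix x1 x2 :: "(real^2^2) \<times> (real^2^2)"
  assume "x1 \<in> Sym_pos \<times> Sym_pos" "x2 \<in> Sym_pos \<times> Sym_pos" and S: "S_map x1 = S_map x2"
  then obtain \<theta>1 \<theta>1' \<theta>2 \<theta>2' where x: "x1 = (\<theta>1, \<theta>1')" "x2 = (\<theta>2, \<theta>2')"
    and \<theta>1: "\<theta>1 \<in> Sym_pos" "\<theta>1' \<in> Sym_pos" and \<theta>2: "\<theta>2 \<in> Sym_pos" "\<theta>2' \<in> Sym_pos"
    by auto
  obtain M a b where M: "det M = 1" "b \<le> a" "a * b = det \<theta>1'"
    "a + b = sqrt (det \<theta>1) * trace (\<theta>1' ** matrix_inv \<theta>1)"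
    "congr M \<theta>1 = mat2 (sqrt (det \<theta>1)) 0 0 (sqrt (det \<theta>1))" "congr M \<theta>1' = mat2 a 0 0 b"
    using normal_form [OF \<theta>1] .
  obtain N a' b' where N: "det N = 1" "b' \<le> a'" "a' * b' = det \<theta>2'"
    "a' + b' = sqrt (det \<theta>2) * trace (\<theta>2' ** matrix_inv \<theta>2)"
    "congr N \<theta>2 = mat2 (sqrt (det \<theta>2)) 0 0 (sqrt (det \<theta>2))" "congr N \<theta>2' = mat2 a' 0 0 b'"
    using normal_form [OF \<theta>2] .
  have S': "det \<theta>1 = det \<theta>2" "det \<theta>1' = det \<theta>2'"
    "trace (\<theta>1' ** matrix_inv \<theta>1) = trace (\<theta>2' ** matrix_inv \<theta>2)"
    using S by (simp_all add: x S_map_def)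
  then have "a = a' \<and> b = b'"
    using M N by (intro sum_prod_ordered_unique) simp_all
  then have eq: "congr M \<theta>1 = congr N \<theta>2" "congr M \<theta>1' = congr N \<theta>2'"
    using M N S' by simp_all
  have undo: "congr (matrix_inv N) (congr N A) = A" for A
    by (simp add: congr_congr N matrix_inv_SL)
  \<comment> \<open>The action of \<open>?g\<close> is congruence by its inverse
    \<open>M ** matrix_inv N\<close>: first \<open>M\<close> takes \<open>x1\<close> to the common
    normal form, then \<open>matrix_inv N\<close> leads from there to \<open>x2\<close>.\<close>
  let ?g = "N ** matrix_inv M"
  have "?g ** (M ** matrix_inv N) = N ** (matrix_inv M ** M) ** matrix_inv N"
    by (simp only: matrix_mul_assoc)
  then have "matrix_inv ?g = M ** matrix_inv N"
    by (intro matrix_inv_eq) (simp add: M N matrix_inv_SL)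
  then have "x2 = congr_action ?g x1"
    using undo eq by (simp add: x \<theta>1 congr_action_eq flip: congr_congr)
  moreover have "?g \<in> carrier SL"
    by (simp add: SL_def det_mul M N matrix_inv_SL)
  ultimately show "\<exists>g\<in>carrier SL. x2 = congr_action g x1" ..
qed

end
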